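(* Let $d\ge1$ and let $L$ be a non-zero subgroup of $(\mathbb{Z}^{d},+)$ generated by a single element $(a_1,\dots,a_d)$. Then $L$ is an ideal of the ring $\mathbb{Z}^d$ if and only if all but one of the $a_i$'s are zero.
   Context: $\mathbb{Z}^d$ is the product ring with componentwise operations. "All but one of the $a_i$'s are zero" means that exactly one $a_i$ is non-zero. *)

theory Defs
  imports "HOL-Algebra.Algebra"
begin

definition int_power_ring :: "nat \<Rightarrow> int list ring"
  where "int_power_ring d = RDirProd_list (replicate d \<Z>)"

text \<open>
  Elements are integer lists of length \<open>d\<close>, and the ring operations act componentwise.
\<close>

lemma int_power_ring_Suc:
  "int_power_ring (Suc d) =
     image_ring (\<lambda>(x, xs). x # xs) (RDirProd \<Z> (int_power_ring d))"
  by (simp add: int_power_ring_def RDirProd_list_def)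

lemma carrier_int_power_ring:
  "carrier (int_power_ring d) = {xs. length xs = d}"
  by (induction d)
    (auto simp: int_power_ring_def RDirProd_list_carrier image_iff length_Suc_conv)

lemma zero_int_power_ring: "\<zero>\<^bsub>int_power_ring d\<^esub> = replicate d 0"
  by (induction d) (simp_all add: int_power_ring_def RDirProd_list_zero monoid.defs)

lemma one_int_power_ring: "\<one>\<^bsub>int_power_ring d\<^esub> = replicate d 1"
  by (induction d) (simp_all add: int_power_ring_def RDirProd_list_one monoid.defs)

lemma inv_into_Cons:
  assumes "(x, xs) \<in> A"
  shows "inv_into A (\<lambda>(x, xs). x # xs) (x # xs) = (x, xs)"
proof -
  have "inj_on (\<lambda>(x, xs). x # xs) A"
    by (auto simp: inj_on_def)
  from inv_into_f_f[OF this assms] show ?thesis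
    by simp
qed

lemma add_int_power_ring:
  assumes "length xs = d" "length ys = d"
  shows "xs \<oplus>\<^bsub>int_power_ring d\<^esub> ys = map2 (+) xs ys"
  using assms
proof (induction d arbitrary: xs ys)
  case 0
  then show ?case by (simp add: int_power_ring_def monoid.defs)
next
  case (Suc d)
  then show ?case
    by (auto simp: length_Suc_conv int_power_ring_Suc image_ring_def RDirProd_def DirProd_def
        monoid.defs inv_into_Cons carrier_int_power_ring)
qed

lemma mult_int_power_ring:
  assumes "length xs = d" "length ys = d"
  shows "xs \<otimes>\<^bsub>int_power_ring d\<^esub> ys = map2 (*) xs ys"
  using assms
proof (induction d arbitrary: xs ys)
  case 0
  then show ?case by (simp add: int_power_ring_def monoid.defs)
next
  case (Suc d)
  then show ?case
    by (auto simp: length_Suc_conv int_power_ring_Suc image_ring_def image_group_def RDirProd_def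
        DirProd_def monoid.defs inv_into_Cons carrier_int_power_ring)
qed

end

theory Submission
  imports Defs
begin

text \<open>
  The cyclic group generated by \<open>a\<close> consists of the scalar multiples \<open>k \<cdot> a\<close> with \<open>k\<close> an integer,
  whereas multiplication in the product ring scales each coordinate by its own factor.  The subgroup
  is an ideal precisely when coordinatewise scaling of \<open>a\<close> never does more than scaling by a
  single integer.

  If \<open>a\<close> has a single non-zero entry, at position \<open>i\<close>, then only the factor at \<open>i\<close> matters:
  \<open>x * (k \<cdot> a) = (x\<^sub>i * k) \<cdot> a\<close>, so the subgroup absorbs products.  Conversely, suppose that the
  entries of \<open>a\<close> at \<open>i\<close> and \<open>j\<close> are both non-zero, with \<open>i \<noteq> j\<close>.  Multiplying \<open>a\<close> by the \<open>i\<close>-th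
  standard idempotent keeps the entry at \<open>i\<close> and kills the one at \<open>j\<close>; no single integer \<open>k\<close> does
  both, since the entry at \<open>i\<close> forces \<open>k = 1\<close> and the one at \<open>j\<close> forces \<open>k = 0\<close>.  A non-zero
  subgroup has a non-zero generator, which gives the existence of a non-zero entry.
\<close>

lemma ring_int_power_ring: "ring (int_power_ring d)"
  unfolding int_power_ring_def
  by (rule RDirProd_list_is_ring) (simp add: cring.axioms(1) int_is_cring)

text \<open>Only the step from \<open>k\<close> to \<open>k + 1\<close> is computed; the step down follows from it by cancellation.\<close>

lemma add_pow_int_power_ring:
  assumes "length a = d"
  shows "add_pow (int_power_ring d) (k :: int) a = map ((*) k) a"
proof -
  interpret ring "int_power_ring d" by (rule ring_int_power_ring)
  let ?pow = "\<lambda>k :: int. add_pow (int_power_ring d) k a"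
  have a: "a \<in> carrier (int_power_ring d)"
    using assms by (simp add: carrier_int_power_ring)
  have pow_step: "?pow (k + 1) = ?pow k \<oplus>\<^bsub>int_power_ring d\<^esub> a" for k
    using add.int_pow_mult[OF a, of k 1] a by simp
  have map_step: "map ((*) (k + 1)) a = map ((*) k) a \<oplus>\<^bsub>int_power_ring d\<^esub> a" for k :: int
    using assms by (subst add_int_power_ring) (auto intro!: nth_equalityI simp: algebra_simps)
  show ?thesis
  proof (induction k rule: int_induct[where k = 0])
    case base
    show ?case
      using assms by (simp add: add_pow_int_ge zero_int_power_ring map_replicate_const)
  next
    case (step1 k)
    then show ?case by (simp only: pow_step map_step)
  next
    case (step2 k)
    have "?pow (k - 1) \<oplus>\<^bsub>int_power_ring d\<^esub> a
        = map ((*) (k - 1)) a \<oplus>\<^bsub>int_power_ring d\<^esub> a"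
      using step2 pow_step[of "k - 1"] map_step[of "k - 1"] by simp
    moreover have "?pow (k - 1) \<in> carrier (int_power_ring d)"
      using add.int_pow_closed[OF a] by simp
    moreover have "map ((*) (k - 1)) a \<in> carrier (int_power_ring d)"
      using assms by (simp add: carrier_int_power_ring)
    ultimately show ?case
      using a add.right_cancel by blast
  qed
qed

lemma generate_singleton_int_power_ring:
  assumes "length a = d"
  shows "generate (add_monoid (int_power_ring d)) {a} = range (\<lambda>k. map ((*) k) a)"
proof -
  interpret ring "int_power_ring d" by (rule ring_int_power_ring)
  have "a \<in> carrier (add_monoid (int_power_ring d))"
    using assms by (simp add: carrier_int_power_ring)
  from group.generate_pow[OF add.is_group this]
  have "generate (add_monoid (int_power_ring d)) {a}
      = range (\<lambda>k :: int. add_pow (int_power_ring d) k a)"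
    unfolding add_pow_def by (simp only: full_SetCompr_eq UNIV_I simp_thms)
  then show ?thesis
    by (simp only: add_pow_int_power_ring[OF assms])
qed

text \<open>The separating product is the one with the standard idempotent at \<open>i\<close>.\<close>

lemma ideal_scalar_multiples_support_unique:
  assumes len: "length a = d"
    and ideal: "ideal (range (\<lambda>k. map ((*) k) a)) (int_power_ring d)"
    and i: "i < d" "a ! i \<noteq> 0" and j: "j < d" "a ! j \<noteq> 0"
  shows "i = j"
proof (rule ccontr)
  assume "i \<noteq> j"
  let ?e = "(replicate d (0 :: int))[i := 1]"
  have "a = map ((*) 1) a"
    by (auto intro!: nth_equalityI)
  then have "a \<in> range (\<lambda>k. map ((*) k) a)" by blast
  moreover have "?e \<in> carrier (int_power_ring d)"
    by (simp add: carrier_int_power_ring)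
  ultimately have "?e \<otimes>\<^bsub>int_power_ring d\<^esub> a \<in> range (\<lambda>k. map ((*) k) a)"
    by (rule ideal.I_l_closed[OF ideal])
  then obtain k where k: "map2 (*) ?e a = map ((*) k) a"
    using len by (auto simp: mult_int_power_ring)
  have "a ! i = k * a ! i"
    using arg_cong[OF k, of "\<lambda>xs. xs ! i"] i(1) len by simp
  moreover have "0 = k * a ! j"
    using arg_cong[OF k, of "\<lambda>xs. xs ! j"] j(1) len \<open>i \<noteq> j\<close> by simp
  ultimately show False
    using i(2) j(2) by simp
qed

text \<open>All coordinates other than \<open>i\<close> vanish on both sides, so \<open>x\<close> acts through its entry at \<open>i\<close>.\<close>

lemma map2_times_scalar_multiple_single_support:
  fixes a x :: "int list"
  assumes "length a = d" "length x = d"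
    and "\<And>j. j < d \<Longrightarrow> a ! j \<noteq> 0 \<Longrightarrow> j = i"
  shows "map2 (*) x (map ((*) k) a) = map ((*) (x ! i * k)) a"
    and "map2 (*) (map ((*) k) a) x = map ((*) (x ! i * k)) a"
proof -
  have eq: "x ! j * (k * a ! j) = x ! i * k * a ! j" if "j < d" for j
    using assms(3)[OF that] by (cases "a ! j = 0") auto
  show "map2 (*) x (map ((*) k) a) = map ((*) (x ! i * k)) a"
    using assms(1,2) eq by (auto intro!: nth_equalityI)
  show "map2 (*) (map ((*) k) a) x = map ((*) (x ! i * k)) a"
    using assms(1,2) eq by (auto intro!: nth_equalityI simp: mult.commute)
qed

theorem proposition3p1:
  fixes d :: nat and L :: "int list set" and a :: "int list"
  assumes "d \<ge> 1"
    and "subgroup L (add_monoid (int_power_ring d))"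
    and "L \<noteq> {\<zero>\<^bsub>int_power_ring d\<^esub>}"
    and "a \<in> carrier (int_power_ring d)"
    and "L = generate (add_monoid (int_power_ring d)) {a}"
  shows "ideal L (int_power_ring d) \<longleftrightarrow> (\<exists>!i. i < d \<and> a ! i \<noteq> 0)"
proof -
  have len: "length a = d"
    using assms(4) by (simp add: carrier_int_power_ring)
  have L: "L = range (\<lambda>k. map ((*) k) a)"
    using assms(5) generate_singleton_int_power_ring[OF len] by simp
  show ?thesis
  proof
    assume ideal: "ideal L (int_power_ring d)"
    have "\<exists>i < d. a ! i \<noteq> 0"
    proof (rule ccontr)
      assume "\<not> (\<exists>i < d. a ! i \<noteq> 0)"
      then have "map ((*) k) a = replicate d 0" for k
        using len by (auto intro!: nth_equalityI)
      then have "L = {\<zero>\<^bsub>int_power_ring d\<^esub>}"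
        by (auto simp: L zero_int_power_ring)
      with assms(3) show False by simp
    qed
    then show "\<exists>!i. i < d \<and> a ! i \<noteq> 0"
      using ideal_scalar_multiples_support_unique[OF len ideal[unfolded L]] by blast
  next
    assume "\<exists>!i. i < d \<and> a ! i \<noteq> 0"
    then obtain i where i: "\<And>j. j < d \<Longrightarrow> a ! j \<noteq> 0 \<Longrightarrow> j = i"
      by blast
    show "ideal L (int_power_ring d)"
    proof (rule idealI)
      show "ring (int_power_ring d)" by (rule ring_int_power_ring)
      show "subgroup L (add_monoid (int_power_ring d))" by (rule assms(2))
    next
      fix b x
      assume "b \<in> L" and "x \<in> carrier (int_power_ring d)"
      then obtain k where b: "b = map ((*) k) a" and x: "length x = d"
        by (auto simp: L carrier_int_power_ring)
      note absorb = map2_times_scalar_multiple_single_support[OF len x i]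
      have "x \<otimes>\<^bsub>int_power_ring d\<^esub> b = map ((*) (x ! i * k)) a"
        and "b \<otimes>\<^bsub>int_power_ring d\<^esub> x = map ((*) (x ! i * k)) a"
        using len x by (simp_all add: b mult_int_power_ring absorb)
      then show "x \<otimes>\<^bsub>int_power_ring d\<^esub> b \<in> L" and "b \<otimes>\<^bsub>int_power_ring d\<^esub> x \<in> L"
        unfolding L by (metis rangeI)+
    qed
  qed
qed

end
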